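(* The (set-valued) function $A\mapsto\sigma_{ap}(A)$ is upper semi-continuous on the metric space $(\mathbb{R}_+^{\infty\times\infty},d)$.
   Context: $\mathbb{R}_+^{\infty\times\infty}$ is the set of infinite matrices $A=(a_{ij})_{i,j\in\mathbb{N}}$ with non-negative real entries and $\|A\|:=\sup\{a_{ij}:i,j\in\mathbb{N}\}<\infty$, with the metric $d(A,B)=\|A-B\|=\sup\{|a_{ij}-b_{ij}|:i,j\in\mathbb{N}\}$. $\ell^\infty_+$ is the set of bounded non-negative sequences, with the norm $\|x\|=\sup_i|x_i|$ of $\ell^\infty$. The max-algebra action is $(A\otimes x)_i=\sup_{j\in\mathbb{N}}a_{ij}x_j$. The approximate point spectrum $\sigma_{ap}(A)$ in max algebra is the set of all $t\ge0$ such that $\inf\{\|A\otimes x-tx\|:x\in\ell^\infty_+,\ \|x\|=1\}=0$. Upper semi-continuity of a set-valued map is in the usual sense: for every $A$ and every open set $U\supset\sigma_{ap}(A)$ there is $\delta>0$ such that $\sigma_{ap}(B)\subset U$ whenever $d(A,B)<\delta$. *)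

theory Defs
  imports "HOL-Analysis.Bounded_Continuous_Function"
begin

text \<open>
  Both \<^typ>\<open>nat\<close> and \<^typ>\<open>nat \<times> nat\<close> are discrete, so continuity is no restriction on
  functions defined on them (see \<open>bounded_matrix_in_bcontfun\<close> and
  \<open>bounded_sequence_in_bcontfun\<close> below). Hence \<open>nat \<Rightarrow>\<^sub>C real\<close> is \<open>\<ell>\<^sup>\<infinity>\<close> and
  \<open>(nat \<times> nat) \<Rightarrow>\<^sub>C real\<close> is the space of bounded infinite matrices, both carrying the
  supremum norm and the supremum metric of the library.
\<close>

type_synonym bounded_matrix = "(nat \<times> nat) \<Rightarrow>\<^sub>C real"

type_synonym linfty = "nat \<Rightarrow>\<^sub>C real"

lemma bounded_matrix_in_bcontfun:
  fixes a :: "nat \<times> nat \<Rightarrow> real"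
  assumes "bounded (range a)"
  shows "a \<in> bcontfun"
proof -
  have "open {p}" for p :: "nat \<times> nat"
    using open_Times[of "{fst p}" "{snd p}"] by (simp add: open_discrete)
  then have "open S" for S :: "(nat \<times> nat) set"
    using open_UN[of S "\<lambda>p. {p}"] by simp
  then have "continuous_on UNIV a"
    by (simp add: continuous_on_open_vimage)
  with assms show ?thesis
    by (simp add: bcontfun_def)
qed

lemma bounded_sequence_in_bcontfun:
  fixes x :: "nat \<Rightarrow> real"
  assumes "bounded (range x)"
  shows "x \<in> bcontfun"
  using assms by (simp add: bcontfun_def)

lemma dist_bounded_matrix:
  fixes A B :: bounded_matrix
  shows "dist A B = (SUP (i, j). \<bar>A (i, j) - B (i, j)\<bar>)"
  by (simp add: dist_bcontfun.rep_eq dist_real_def case_prod_beta)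

lemma norm_linfty:
  fixes x :: linfty
  shows "norm x = (SUP i. \<bar>x i\<bar>)"
  by (simp add: norm_bcontfun_def dist_bcontfun.rep_eq dist_real_def zero_bcontfun.rep_eq)

definition nonneg_matrices :: "bounded_matrix set" where
  "nonneg_matrices = {A :: bounded_matrix. \<forall>i j. 0 \<le> A (i, j)}"

definition linfty_nonneg :: "linfty set" where
  "linfty_nonneg = {x :: linfty. \<forall>i. 0 \<le> x i}"

definition max_times :: "bounded_matrix \<Rightarrow> linfty \<Rightarrow> linfty" (infixl "\<otimes>" 70) where
  "A \<otimes> x = Bcontfun (\<lambda>i. SUP j. A (i, j) * x j)"

lemma max_times_apply: "(A \<otimes> x) i = (SUP j. A (i, j) * x j)"
proof -
  have *: "\<bar>A (k, j) * x j\<bar> \<le> norm A * norm x" for k j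
    unfolding abs_mult
    using norm_bounded[of A "(k, j)"] norm_bounded[of x j] by (intro mult_mono) auto
  have "\<bar>SUP j. A (k, j) * x j\<bar> \<le> norm A * norm x" for k
    by (rule cSup_abs_le) (use * in auto)
  then have "(\<lambda>i. SUP j. A (i, j) * x j) \<in> bcontfun"
    by (intro bounded_sequence_in_bcontfun) (auto simp: bounded_iff)
  then show ?thesis
    by (simp add: max_times_def Bcontfun_inverse)
qed

definition approx_point_spectrum :: "bounded_matrix \<Rightarrow> real set" ("\<sigma>\<^sub>a\<^sub>p") where
  "\<sigma>\<^sub>a\<^sub>p A = {t. 0 \<le> t \<and>
     Inf {norm (A \<otimes> x - t *\<^sub>R x) | x. x \<in> linfty_nonneg \<and> norm x = 1} = 0}"

definition upper_semicontinuous_on ::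
  "'a::metric_space set \<Rightarrow> ('a \<Rightarrow> 'b::topological_space set) \<Rightarrow> bool" where
  "upper_semicontinuous_on M F \<longleftrightarrow>
     (\<forall>A\<in>M. \<forall>U. open U \<and> F A \<subseteq> U \<longrightarrow>
        (\<exists>\<delta>>0. \<forall>B\<in>M. dist A B < \<delta> \<longrightarrow> F B \<subseteq> U))"

end

theory Submission
  imports Defs
begin

text \<open>
  Let \<open>g A t\<close> be the infimum of \<open>\<parallel>A \<otimes> x - t x\<parallel>\<close> over the non-negative unit vectors \<open>x\<close>.
  Since \<open>\<parallel>A \<otimes> x - B \<otimes> x\<parallel> \<le> \<parallel>A - B\<parallel> \<parallel>x\<parallel>\<close>, this is 1-Lipschitz in \<open>A\<close> and in \<open>t\<close>. Its zeros lie
  below \<open>\<parallel>A\<parallel>\<close>, so it is bounded below by some \<open>m > 0\<close> on the compact set of those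
  \<open>t \<le> \<parallel>A\<parallel> + 1\<close> that lie outside a given neighbourhood of the spectrum. A perturbation of size
  less than \<open>min m 1\<close> therefore creates no spectrum outside the neighbourhood.
\<close>

lemma bdd_above_max_times: "bdd_above (range (\<lambda>j. A (i, j) * x j))"
  for A :: bounded_matrix and x :: linfty
proof (rule bdd_aboveI2)
  fix j
  have "\<bar>A (i, j) * x j\<bar> \<le> norm A * norm x"
    unfolding abs_mult
    using norm_bounded[of A "(i, j)"] norm_bounded[of x j] by (intro mult_mono) auto
  then show "A (i, j) * x j \<le> norm A * norm x"
    by linarith
qed

text \<open>The bound holds for each term \<open>A (i, j) * x j\<close>, with an error independent
  of \<open>j\<close>, so it survives the supremum.\<close>

lemma max_times_diff_le:
  fixes A B :: bounded_matrix and x :: linfty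
  shows "(A \<otimes> x) i \<le> (B \<otimes> x) i + dist A B * norm x"
  unfolding max_times_apply
proof (rule cSUP_least)
  fix j
  have "\<bar>(A (i, j) - B (i, j)) * x j\<bar> \<le> dist A B * norm x"
    unfolding abs_mult
    using dist_bounded[of A "(i, j)" B] norm_bounded[of x j]
    by (intro mult_mono) (auto simp: dist_real_def)
  then have "A (i, j) * x j \<le> B (i, j) * x j + dist A B * norm x"
    by (simp add: algebra_simps abs_le_iff)
  also have "B (i, j) * x j \<le> (SUP j. B (i, j) * x j)"
    by (intro cSUP_upper bdd_above_max_times) simp
  finally show "A (i, j) * x j \<le> (SUP j. B (i, j) * x j) + dist A B * norm x"
    by simp
qed simp

lemma norm_max_times_diff_le: "norm (A \<otimes> x - B \<otimes> x) \<le> dist A B * norm x"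
proof (rule norm_bound)
  fix i
  show "norm ((A \<otimes> x - B \<otimes> x) i) \<le> dist A B * norm x"
    using max_times_diff_le[of A x i B] max_times_diff_le[of B x i A]
    by (simp add: abs_le_iff dist_commute)
qed

lemma max_times_zero_left: "0 \<otimes> x = 0"
  by (rule bcontfun_eqI) (simp add: max_times_apply)

text \<open>Comparison of \<open>A\<close> with the zero matrix.\<close>

lemma norm_max_times_le: "norm (A \<otimes> x) \<le> norm A * norm x"
  using norm_max_times_diff_le[of A x 0] by (simp add: max_times_zero_left)

definition unit_nonneg :: "linfty set" where
  "unit_nonneg = {x. x \<in> linfty_nonneg \<and> norm x = 1}"

definition spectral_defect :: "bounded_matrix \<Rightarrow> real \<Rightarrow> real" where
  "spectral_defect A t = (INF x\<in>unit_nonneg. norm (A \<otimes> x - t *\<^sub>R x))"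

text \<open>Lower bounds pass to a real infimum only over a nonempty set.\<close>

lemma unit_nonneg_nonempty: "unit_nonneg \<noteq> {}"
proof -
  have "const_bcontfun 1 \<in> unit_nonneg"
    by (simp add: unit_nonneg_def linfty_nonneg_def norm_linfty)
  then show ?thesis by blast
qed

lemma spectral_defect_le: "x \<in> unit_nonneg \<Longrightarrow> spectral_defect A t \<le> norm (A \<otimes> x - t *\<^sub>R x)"
  unfolding spectral_defect_def by (rule cINF_lower) (auto intro: bdd_belowI2[where m = 0])

lemma spectral_defect_nonneg: "0 \<le> spectral_defect A t"
  unfolding spectral_defect_def by (rule cINF_greatest[OF unit_nonneg_nonempty]) simp

lemma approx_point_spectrum_iff: "t \<in> \<sigma>\<^sub>a\<^sub>p A \<longleftrightarrow> 0 \<le> t \<and> spectral_defect A t = 0"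
proof -
  have "{norm (A \<otimes> x - t *\<^sub>R x) | x. x \<in> linfty_nonneg \<and> norm x = 1}
    = (\<lambda>x. norm (A \<otimes> x - t *\<^sub>R x)) ` unit_nonneg"
    by (auto simp: unit_nonneg_def)
  then show ?thesis
    by (simp add: approx_point_spectrum_def spectral_defect_def)
qed

text \<open>Used twice: with \<open>A = B\<close> for continuity in \<open>t\<close>, and with
  \<open>t = s\<close> for perturbing the matrix.\<close>

lemma spectral_defect_lipschitz:
  "spectral_defect A t \<le> spectral_defect B s + (dist A B + \<bar>t - s\<bar>)"
proof -
  have "spectral_defect A t - (dist A B + \<bar>t - s\<bar>) \<le> norm (B \<otimes> x - s *\<^sub>R x)"
    if x: "x \<in> unit_nonneg" for x
  proof -
    \<comment> \<open>The outer terms are the costs of changing the matrix and the scalar; as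
      \<open>x\<close> has norm 1, both are bounded uniformly in \<open>x\<close>.\<close>
    have eq: "A \<otimes> x - t *\<^sub>R x = (A \<otimes> x - B \<otimes> x) + (B \<otimes> x - s *\<^sub>R x) + (s - t) *\<^sub>R x"
      by (simp add: algebra_simps)
    have "norm (A \<otimes> x - t *\<^sub>R x)
        \<le> norm (A \<otimes> x - B \<otimes> x) + norm (B \<otimes> x - s *\<^sub>R x) + norm ((s - t) *\<^sub>R x)"
      unfolding eq by (intro norm_triangle_le add_right_mono norm_triangle_ineq)
    moreover have "norm (A \<otimes> x - B \<otimes> x) \<le> dist A B" "norm ((s - t) *\<^sub>R x) = \<bar>t - s\<bar>"
      using norm_max_times_diff_le[of A x B] x by (auto simp: unit_nonneg_def)
    ultimately show ?thesis
      using spectral_defect_le[OF x, of A t] by linarith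
  qed
  then have "spectral_defect A t - (dist A B + \<bar>t - s\<bar>) \<le> spectral_defect B s"
    unfolding spectral_defect_def[of B] by (intro cINF_greatest[OF unit_nonneg_nonempty])
  then show ?thesis by linarith
qed

lemma continuous_on_spectral_defect: "continuous_on S (spectral_defect A)"
proof (rule continuous_on_subset)
  show "continuous_on UNIV (spectral_defect A)"
    unfolding continuous_on_iff
  proof (intro ballI allI impI)
    fix t e :: real
    assume "0 < e"
    moreover have "dist (spectral_defect A s) (spectral_defect A t) \<le> dist s t" for s
      using spectral_defect_lipschitz[of A s A t] spectral_defect_lipschitz[of A t A s]
      by (simp add: dist_real_def)
    ultimately show "\<exists>d>0. \<forall>s\<in>UNIV. dist s t < d \<longrightarrow>
        dist (spectral_defect A s) (spectral_defect A t) < e"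
      by (intro exI[of _ e]) (auto intro: order.strict_trans1)
  qed
qed simp

text \<open>On unit vectors \<open>t *\<^sub>R x\<close> has norm \<open>t\<close> while
  \<open>A \<otimes> x\<close> has norm at most \<open>norm A\<close>, so the defect is at least
  \<open>t - norm A\<close>.\<close>

lemma approx_point_spectrum_le_norm:
  assumes "t \<in> \<sigma>\<^sub>a\<^sub>p A"
  shows "t \<le> norm A"
proof -
  have "t - norm A \<le> norm (A \<otimes> x - t *\<^sub>R x)" if "x \<in> unit_nonneg" for x
    using norm_triangle_ineq2[of "t *\<^sub>R x" "A \<otimes> x"] norm_max_times_le[of A x] that assms
    by (simp add: unit_nonneg_def approx_point_spectrum_iff norm_minus_commute[of "t *\<^sub>R x"])
  then have "t - norm A \<le> spectral_defect A t"
    unfolding spectral_defect_def by (intro cINF_greatest[OF unit_nonneg_nonempty])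
  then show ?thesis
    using assms by (simp add: approx_point_spectrum_iff)
qed

lemma approx_point_spectrum_upper_semicontinuous:
  assumes "open U" "\<sigma>\<^sub>a\<^sub>p A \<subseteq> U"
  shows "\<exists>\<delta>>0. \<forall>B. dist A B < \<delta> \<longrightarrow> \<sigma>\<^sub>a\<^sub>p B \<subseteq> U"
proof -
  \<comment> \<open>The extra 1 leaves room for the spectra of all \<open>B\<close> at distance less
    than 1 from \<open>A\<close>.\<close>
  define K where "K = {0..norm A + 1} - U"
  have "compact K"
    unfolding K_def using assms(1) by (intro compact_diff) auto
  have pos: "0 < spectral_defect A t" if "t \<in> K" for t
  proof -
    have "0 \<le> t" "t \<notin> \<sigma>\<^sub>a\<^sub>p A"
      using that assms(2) by (auto simp: K_def)
    then show ?thesis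
      using spectral_defect_nonneg[of A t] by (simp add: approx_point_spectrum_iff)
  qed
  obtain m where m: "0 < m" "\<And>t. t \<in> K \<Longrightarrow> m \<le> spectral_defect A t"
  proof (cases "K = {}")
    case True
    then show ?thesis using that[of 1] by simp
  next
    case False
    then obtain t where "t \<in> K" "\<forall>s\<in>K. spectral_defect A t \<le> spectral_defect A s"
      using continuous_attains_inf[OF \<open>compact K\<close> False continuous_on_spectral_defect] by metis
    then show ?thesis
      by (intro that[of "spectral_defect A t"] pos) auto
  qed
  \<comment> \<open>The bound 1 forces a spectral value \<open>t\<close> outside \<open>U\<close>
    into \<open>K\<close>; the bound \<open>m\<close> then contradicts the minimum there.\<close>
  have "t \<in> U" if B: "dist A B < min m 1" and t: "t \<in> \<sigma>\<^sub>a\<^sub>p B" for B t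
  proof (rule ccontr)
    assume "t \<notin> U"
    have "norm B \<le> norm A + dist A B"
      using norm_triangle_sub[of B A] by (simp add: dist_norm norm_minus_commute[of A])
    then have "t \<in> K"
      using approx_point_spectrum_le_norm[OF t] t B \<open>t \<notin> U\<close>
      by (simp add: K_def approx_point_spectrum_iff)
    \<comment> \<open>The defect of \<open>B\<close> at \<open>t\<close> vanishes, so only the
      Lipschitz error remains.\<close>
    moreover have "spectral_defect A t \<le> dist A B"
      using spectral_defect_lipschitz[of A t B t] t by (simp add: approx_point_spectrum_iff)
    ultimately show False
      using m(2)[of t] B by simp
  qed
  then show ?thesis
    using m(1) by (intro exI[of _ "min m 1"]) auto
qed

theorem proposition5p4:
  shows "upper_semicontinuous_on nonneg_matrices \<sigma>\<^sub>a\<^sub>p"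
  unfolding upper_semicontinuous_on_def
proof (intro ballI allI impI)
  fix A U
  assume "open U \<and> \<sigma>\<^sub>a\<^sub>p A \<subseteq> U"
  then obtain \<delta> where "0 < \<delta>" "\<forall>B. dist A B < \<delta> \<longrightarrow> \<sigma>\<^sub>a\<^sub>p B \<subseteq> U"
    using approx_point_spectrum_upper_semicontinuous[of U A] by auto
  then show "\<exists>\<delta>>0. \<forall>B\<in>nonneg_matrices. dist A B < \<delta> \<longrightarrow> \<sigma>\<^sub>a\<^sub>p B \<subseteq> U"
    by (intro exI[of _ \<delta>]) simp
qed

end
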